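(* Let $A$ be a skew left brace. There is a one-to-one correspondence between the set of equivalence classes of irreducible representations of the skew left brace $A$ and the set of equivalence classes of irreducible representations of the group $\Lambda_{A^{\mathrm{op}}}$ (representations being taken over a fixed field).
   Context: A skew left brace is a triple $(A,\cdot,\circ)$ where $(A,\cdot)$ and $(A,\circ)$ are groups with $a\circ(b\cdot c)=(a\circ b)\cdot a^{-1}\cdot(a\circ c)$ for all $a,b,c\in A$, where $a^{-1}$ is the inverse in $(A,\cdot)$. We write $ab=a\cdot b$; the two groups share the identity $1$. The map $\lambda^{\mathrm{op}}:(A,\circ)\to\mathrm{Aut}(A,\cdot)$, $\lambda^{\mathrm{op}}_a(b)=(a\circ b)a^{-1}$, is a group homomorphism. The group $\Lambda_{A^{\mathrm{op}}}=(A,\cdot)\rtimes_{\lambda^{\mathrm{op}}}(A,\circ)$ is the set $A\times A$ with product $(a_1,b_1)(a_2,b_2)=(a_1\lambda^{\mathrm{op}}_{b_1}(a_2),\,b_1\circ b_2)$. A representation of a skew left brace $A$ is a triple $(V,\beta,\rho)$ where $V$ is a vector space over a field, $\beta:(A,\cdot)\to\mathrm{GL}(V)$ and $\rho:(A,\circ)\to\mathrm{GL}(V)$ are group homomorphisms, and $\beta(\lambda^{\mathrm{op}}_a(b))=\rho(a)\beta(b)\rho(a)^{-1}$ for all $a,b\in A$. Any such triple gives a representation $(V,\varphi_{(\beta,\rho)})$ of the group $\Lambda_{A^{\mathrm{op}}}$ by $\varphi_{(\beta,\rho)}(a,b)=\beta(a)\rho(b)$. The representation $(V,\beta,\rho)$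 of $A$ is called irreducible if $(V,\varphi_{(\beta,\rho)})$ is an irreducible representation of $\Lambda_{A^{\mathrm{op}}}$. Two representations $(V_1,\beta_1,\rho_1)$ and $(V_2,\beta_2,\rho_2)$ of $A$ are called equivalent if $(V_1,\varphi_{(\beta_1,\rho_1)})$ and $(V_2,\varphi_{(\beta_2,\rho_2)})$ are equivalent (isomorphic) representations of $\Lambda_{A^{\mathrm{op}}}$. *)

theory Defs
  imports "HOL-Algebra.Module" "HOL-Algebra.Bij"
begin

text \<open>
  The two group structures of a skew left brace are two group records \<open>D\<close> (for \<open>\<cdot>\<close>) and
  \<open>C\<close> (for \<open>\<circ>\<close>) with the same carrier. That they share the identity is a consequence.
\<close>

locale skew_left_brace = D: group D + C: group C
  for D :: "'a monoid" and C :: "'a monoid" +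
  assumes carrier_eq: "carrier C = carrier D"
    and brace_compat: "\<lbrakk>a \<in> carrier D; b \<in> carrier D; c \<in> carrier D\<rbrakk> \<Longrightarrow>
      a \<otimes>\<^bsub>C\<^esub> (b \<otimes>\<^bsub>D\<^esub> c) = (a \<otimes>\<^bsub>C\<^esub> b) \<otimes>\<^bsub>D\<^esub> inv\<^bsub>D\<^esub> a \<otimes>\<^bsub>D\<^esub> (a \<otimes>\<^bsub>C\<^esub> c)"

definition lambda_op :: "'a monoid \<Rightarrow> 'a monoid \<Rightarrow> 'a \<Rightarrow> 'a \<Rightarrow> 'a" where
  "lambda_op D C a b = (a \<otimes>\<^bsub>C\<^esub> b) \<otimes>\<^bsub>D\<^esub> inv\<^bsub>D\<^esub> a"

definition Lambda_op :: "'a monoid \<Rightarrow> 'a monoid \<Rightarrow> ('a \<times> 'a) monoid" where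
  "Lambda_op D C =
    \<lparr>carrier = carrier D \<times> carrier C,
     mult = (\<lambda>(a1, b1) (a2, b2). (a1 \<otimes>\<^bsub>D\<^esub> lambda_op D C b1 a2, b1 \<otimes>\<^bsub>C\<^esub> b2)),
     one = (\<one>\<^bsub>D\<^esub>, \<one>\<^bsub>C\<^esub>)\<rparr>"

text \<open>
  A vector space over a field \<open>K\<close> is a module \<open>V\<close> over \<open>K\<close>, and a subspace is a submodule.
\<close>

definition linear_maps ::
    "'k ring \<Rightarrow> ('k, 'v) module \<Rightarrow> ('k, 'w) module \<Rightarrow> ('v \<Rightarrow> 'w) set" where
  "linear_maps K V W =
    {f \<in> carrier V \<rightarrow> carrier W.
       (\<forall>x \<in> carrier V. \<forall>y \<in> carrier V. f (x \<oplus>\<^bsub>V\<^esub> y) = f x \<oplus>\<^bsub>W\<^esub> f y) \<and>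
       (\<forall>c \<in> carrier K. \<forall>x \<in> carrier V. f (c \<odot>\<^bsub>V\<^esub> x) = c \<odot>\<^bsub>W\<^esub> f x)}"

definition GL :: "'k ring \<Rightarrow> ('k, 'v) module \<Rightarrow> ('v \<Rightarrow> 'v) monoid" where
  "GL K V = (BijGroup (carrier V)) \<lparr>carrier := Bij (carrier V) \<inter> linear_maps K V V\<rparr>"

type_synonym ('g, 'k, 'v) group_rep = "('k, 'v) module \<times> ('g \<Rightarrow> 'v \<Rightarrow> 'v)"

definition is_group_rep :: "'k ring \<Rightarrow> 'g monoid \<Rightarrow> ('g, 'k, 'v) group_rep \<Rightarrow> bool" where
  "is_group_rep K G = (\<lambda>(V, \<phi>). module K V \<and> \<phi> \<in> hom G (GL K V))"

text \<open>As usual, the zero representation does not count as irreducible.\<close>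

definition irreducible_group_rep ::
    "'k ring \<Rightarrow> 'g monoid \<Rightarrow> ('g, 'k, 'v) group_rep \<Rightarrow> bool" where
  "irreducible_group_rep K G = (\<lambda>(V, \<phi>).
     is_group_rep K G (V, \<phi>) \<and> carrier V \<noteq> {\<zero>\<^bsub>V\<^esub>} \<and>
     (\<forall>W. submodule W K V \<and> (\<forall>g \<in> carrier G. \<phi> g ` W \<subseteq> W) \<longrightarrow>
        W = {\<zero>\<^bsub>V\<^esub>} \<or> W = carrier V))"

definition equivalent_group_reps ::
    "'k ring \<Rightarrow> 'g monoid \<Rightarrow> ('g, 'k, 'v) group_rep \<Rightarrow> ('g, 'k, 'w) group_rep \<Rightarrow> bool" where
  "equivalent_group_reps K G = (\<lambda>(V, \<phi>) (W, \<psi>).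
     \<exists>T \<in> linear_maps K V W. bij_betw T (carrier V) (carrier W) \<and>
       (\<forall>g \<in> carrier G. \<forall>v \<in> carrier V. T (\<phi> g v) = \<psi> g (T v)))"

type_synonym ('a, 'k, 'v) brace_rep =
  "('k, 'v) module \<times> ('a \<Rightarrow> 'v \<Rightarrow> 'v) \<times> ('a \<Rightarrow> 'v \<Rightarrow> 'v)"

definition is_brace_rep ::
    "'k ring \<Rightarrow> 'a monoid \<Rightarrow> 'a monoid \<Rightarrow> ('a, 'k, 'v) brace_rep \<Rightarrow> bool" where
  "is_brace_rep K D C = (\<lambda>(V, \<beta>, \<rho>).
     module K V \<and> \<beta> \<in> hom D (GL K V) \<and> \<rho> \<in> hom C (GL K V) \<and>
     (\<forall>a \<in> carrier D. \<forall>b \<in> carrier D.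
        \<beta> (lambda_op D C a b) = \<rho> a \<otimes>\<^bsub>GL K V\<^esub> \<beta> b \<otimes>\<^bsub>GL K V\<^esub> inv\<^bsub>GL K V\<^esub> (\<rho> a)))"

definition Lambda_rep ::
    "'k ring \<Rightarrow> ('a, 'k, 'v) brace_rep \<Rightarrow> ('a \<times> 'a, 'k, 'v) group_rep" where
  "Lambda_rep K = (\<lambda>(V, \<beta>, \<rho>). (V, \<lambda>(a, b). \<beta> a \<otimes>\<^bsub>GL K V\<^esub> \<rho> b))"

definition irreducible_brace_rep ::
    "'k ring \<Rightarrow> 'a monoid \<Rightarrow> 'a monoid \<Rightarrow> ('a, 'k, 'v) brace_rep \<Rightarrow> bool" where
  "irreducible_brace_rep K D C R \<longleftrightarrow>
     is_brace_rep K D C R \<and> irreducible_group_rep K (Lambda_op D C) (Lambda_rep K R)"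

definition equivalent_brace_reps ::
    "'k ring \<Rightarrow> 'a monoid \<Rightarrow> 'a monoid \<Rightarrow> ('a, 'k, 'v) brace_rep \<Rightarrow> ('a, 'k, 'w) brace_rep \<Rightarrow> bool"
  where
  "equivalent_brace_reps K D C R S \<longleftrightarrow>
     equivalent_group_reps K (Lambda_op D C) (Lambda_rep K R) (Lambda_rep K S)"

text \<open>
  Sets of equivalence classes are taken among the representations whose space has its carrier
  in a given type \<open>'v\<close>; the type variable plays the role of a universe. The space of an irreducible
  representation of a group \<open>G\<close> is a quotient of the group algebra \<open>K[G]\<close>, hence isomorphic to a
  subspace of it, so \<open>'v = 'g \<Rightarrow> 'k\<close> already accommodates all irreducible representations up to
  equivalence.
\<close>

definition irr_group_reps :: "'k ring \<Rightarrow> 'g monoid \<Rightarrow> ('g, 'k, 'v) group_rep set" where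
  "irr_group_reps K G = {R. irreducible_group_rep K G R}"

definition irr_group_rep_equiv :: "'k ring \<Rightarrow> 'g monoid \<Rightarrow> ('g, 'k, 'v) group_rep rel" where
  "irr_group_rep_equiv K G =
    {(R, S). R \<in> irr_group_reps K G \<and> S \<in> irr_group_reps K G \<and> equivalent_group_reps K G R S}"

definition irr_brace_reps ::
    "'k ring \<Rightarrow> 'a monoid \<Rightarrow> 'a monoid \<Rightarrow> ('a, 'k, 'v) brace_rep set" where
  "irr_brace_reps K D C = {R. irreducible_brace_rep K D C R}"

definition irr_brace_rep_equiv ::
    "'k ring \<Rightarrow> 'a monoid \<Rightarrow> 'a monoid \<Rightarrow> ('a, 'k, 'v) brace_rep rel" where
  "irr_brace_rep_equiv K D C =
    {(R, S). R \<in> irr_brace_reps K D C \<and> S \<in> irr_brace_reps K D C \<and>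
       equivalent_brace_reps K D C R S}"

end

theory Submission
  imports Defs
begin

text \<open>
  A representation \<open>\<phi>\<close> of \<open>\<Lambda>\<close> is recovered from its restrictions \<open>\<beta> a = \<phi> (a, 1)\<close> and
  \<open>\<rho> b = \<phi> (1, b)\<close>, since \<open>(a, b) = (a, 1) (1, b)\<close>; the compatibility of \<open>\<beta>\<close> and \<open>\<rho>\<close> is the
  relation \<open>(\<lambda>\<^sub>a b, 1) (1, a) = (1, a) (b, 1)\<close>. So every representation of \<open>\<Lambda>\<close> comes from one of
  the brace, and irreducibility and equivalence of brace representations are by definition
  those of the associated representations of \<open>\<Lambda>\<close>.
\<close>

text \<open>The relation \<open>r\<close> is the pullback of \<open>s\<close> along
  \<open>f\<close>, so \<open>f\<close> induces an injective map on classes. It is onto as soon as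
  every \<open>s\<close>-class meets the image of \<open>f\<close>, which is weaker than
  surjectivity of \<open>f\<close>. It will be applied to \<open>Lambda_rep K\<close>.\<close>

lemma bij_betw_quotient_pullback:
  assumes s: "equiv B s" and f: "f ` A \<subseteq> B"
    and r: "r = {(x, y). x \<in> A \<and> y \<in> A \<and> (f x, f y) \<in> s}"
    and ess_surj: "\<And>b. b \<in> B \<Longrightarrow> \<exists>a \<in> A. (f a, b) \<in> s"
  shows "\<exists>F. bij_betw F (A // r) (B // s) \<and> (\<forall>a \<in> A. F (r `` {a}) = s `` {f a})"
proof -
  define F where "F = (\<lambda>X. s `` (f ` X))"
  have refl: "(b, b) \<in> s" if "b \<in> B" for b
    using s that by (meson equivE refl_onD)
  have sym: "(y, x) \<in> s" if "(x, y) \<in> s" for x y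
    using s that by (meson equivE symD)
  have trans: "(x, z) \<in> s" if "(x, y) \<in> s" "(y, z) \<in> s" for x y z
    using s that by (meson equivE transD)
  have F: "F (r `` {a}) = s `` {f a}" if "a \<in> A" for a
  proof
    show "F (r `` {a}) \<subseteq> s `` {f a}"
      unfolding F_def r by (auto intro: trans)
    have "a \<in> r `` {a}"
      using that f refl unfolding r by auto
    then show "s `` {f a} \<subseteq> F (r `` {a})"
      unfolding F_def by blast
  qed
  have "inj_on F (A // r)"
  proof (rule inj_onI)
    fix X Y assume XY: "X \<in> A // r" "Y \<in> A // r" "F X = F Y"
    then obtain a b where ab: "a \<in> A" "b \<in> A" "X = r `` {a}" "Y = r `` {b}"
      by (auto elim!: quotientE)
    then have "s `` {f a} = s `` {f b}"
      using XY F by simp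
    then have "(f a, f b) \<in> s"
      using s f ab by (meson eq_equiv_class image_subset_iff)
    then show "X = Y"
      using ab unfolding r by (auto intro: trans sym)
  qed
  moreover have "F ` (A // r) = B // s"
  proof
    show "F ` (A // r) \<subseteq> B // s"
      using F f by (auto elim!: quotientE intro!: quotientI)
    show "B // s \<subseteq> F ` (A // r)"
    proof
      fix Y assume "Y \<in> B // s"
      then obtain b where b: "b \<in> B" "Y = s `` {b}"
        by (auto elim: quotientE)
      then obtain a where a: "a \<in> A" "(f a, b) \<in> s"
        using ess_surj by blast
      then have "Y = F (r `` {a})"
        using F b s by (metis equiv_class_eq)
      then show "Y \<in> F ` (A // r)"
        using a by (auto intro: quotientI)
    qed
  qed
  ultimately show ?thesis
    using F unfolding bij_betw_def by blast
qed

section \<open>Linear maps and the general linear group\<close>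

lemma linear_mapsD:
  assumes "f \<in> linear_maps K V W"
  shows linear_maps_closed: "x \<in> carrier V \<Longrightarrow> f x \<in> carrier W"
    and linear_maps_add:
      "\<lbrakk>x \<in> carrier V; y \<in> carrier V\<rbrakk> \<Longrightarrow> f (x \<oplus>\<^bsub>V\<^esub> y) = f x \<oplus>\<^bsub>W\<^esub> f y"
    and linear_maps_smult:
      "\<lbrakk>c \<in> carrier K; x \<in> carrier V\<rbrakk> \<Longrightarrow> f (c \<odot>\<^bsub>V\<^esub> x) = c \<odot>\<^bsub>W\<^esub> f x"
  using assms unfolding linear_maps_def by auto

text \<open>Linearity only sees values on the carrier. This allows passing from plain functions to
  the restricted ones that make up \<open>Bij (carrier V)\<close>.\<close>

lemma linear_maps_cong:
  assumes "module K V" and "f \<in> linear_maps K V W" and "\<And>x. x \<in> carrier V \<Longrightarrow> g x = f x"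
  shows "g \<in> linear_maps K V W"
proof -
  interpret V: module K V by fact
  show ?thesis
    using assms(2,3) unfolding linear_maps_def by (auto simp: Pi_iff)
qed

lemma linear_maps_id: "(\<lambda>x. x) \<in> linear_maps K V V"
  unfolding linear_maps_def by auto

lemma linear_maps_comp:
  assumes "f \<in> linear_maps K V W" and "g \<in> linear_maps K W X"
  shows "(\<lambda>x. g (f x)) \<in> linear_maps K V X"
  using assms unfolding linear_maps_def by (auto simp: Pi_iff)

text \<open>Since \<open>f\<close> is injective, an equation between values of the inverse can be
  checked after applying \<open>f\<close>, where it follows from linearity of
  \<open>f\<close>.\<close>

lemma linear_maps_inv_into:
  assumes V: "module K V" and f: "f \<in> linear_maps K V W"
    and bij: "bij_betw f (carrier V) (carrier W)"
  shows "inv_into (carrier V) f \<in> linear_maps K W V"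
proof -
  interpret V: module K V by fact
  let ?g = "inv_into (carrier V) f"
  have g: "?g y \<in> carrier V" "f (?g y) = y" if "y \<in> carrier W" for y
    using bij that by (auto simp: bij_betw_def inv_into_into f_inv_into_f)
  have gI: "?g y = x" if "x \<in> carrier V" "f x = y" for x y
    using bij that by (auto simp: bij_betw_def)
  show ?thesis
    unfolding linear_maps_def
    by (auto intro!: gI simp: g linear_mapsD[OF f])
qed

lemma group_GL:
  assumes V: "module K V"
  shows "group (GL K V)"
proof -
  interpret B: group "BijGroup (carrier V)" by (rule group_BijGroup)
  have "subgroup (Bij (carrier V) \<inter> linear_maps K V V) (BijGroup (carrier V))"
  proof (rule B.subgroupI)
    show "Bij (carrier V) \<inter> linear_maps K V V \<subseteq> carrier (BijGroup (carrier V))"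
      by (simp add: BijGroup_def)
    show "Bij (carrier V) \<inter> linear_maps K V V \<noteq> {}"
    proof -
      have "(\<lambda>x \<in> carrier V. x) \<in> linear_maps K V V"
        by (rule linear_maps_cong[OF V linear_maps_id]) simp
      then show ?thesis
        using id_Bij[of "carrier V"] by blast
    qed
  next
    fix f assume f: "f \<in> Bij (carrier V) \<inter> linear_maps K V V"
    then have "bij_betw f (carrier V) (carrier V)"
      by (simp add: Bij_def)
    then have "inv_into (carrier V) f \<in> linear_maps K V V"
      using f by (intro linear_maps_inv_into[OF V]) simp_all
    then have "restrict (inv_into (carrier V) f) (carrier V) \<in> linear_maps K V V"
      by (rule linear_maps_cong[OF V]) simp
    then show "inv\<^bsub>BijGroup (carrier V)\<^esub> f \<in> Bij (carrier V) \<inter> linear_maps K V V"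
      using f by (simp add: inv_BijGroup restrict_inv_into_Bij)
  next
    fix f g
    assume f: "f \<in> Bij (carrier V) \<inter> linear_maps K V V"
      and g: "g \<in> Bij (carrier V) \<inter> linear_maps K V V"
    then have "(\<lambda>x. f (g x)) \<in> linear_maps K V V"
      using linear_maps_comp[of g K V V f V] by simp
    then have "compose (carrier V) f g \<in> linear_maps K V V"
      by (rule linear_maps_cong[OF V]) (simp add: compose_def)
    then show "f \<otimes>\<^bsub>BijGroup (carrier V)\<^esub> g \<in> Bij (carrier V) \<inter> linear_maps K V V"
      using f g by (simp add: BijGroup_def compose_Bij)
  qed
  from B.subgroup_imp_group[OF this] show ?thesis
    by (simp add: GL_def)
qed

section \<open>Representations of a group up to equivalence\<close>

lemma hom_cong_on_carrier:
  assumes "group G" and "\<phi> \<in> hom G H" and "\<And>g. g \<in> carrier G \<Longrightarrow> \<psi> g = \<phi> g"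
  shows "\<psi> \<in> hom G H"
proof -
  interpret group G by fact
  show ?thesis
    using assms(2,3) unfolding hom_def by (auto simp: Pi_iff)
qed

text \<open>The identity of \<open>V\<close> intertwines the two actions, even if they differ as
  functions outside \<open>carrier G\<close>. The case \<open>\<psi> = \<phi>\<close> gives
  reflexivity.\<close>

lemma equivalent_group_reps_cong:
  assumes "\<And>g. g \<in> carrier G \<Longrightarrow> \<psi> g = \<phi> g"
  shows "equivalent_group_reps K G (V, \<psi>) (V, \<phi>)"
  unfolding equivalent_group_reps_def
  using assms by (auto intro!: bexI[of _ "\<lambda>x. x"] simp: bij_betw_def linear_maps_id)

lemma irreducible_group_rep_cong:
  assumes "group G" and "irreducible_group_rep K G (V, \<phi>)"
    and "\<And>g. g \<in> carrier G \<Longrightarrow> \<psi> g = \<phi> g"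
  shows "irreducible_group_rep K G (V, \<psi>)"
  using assms hom_cong_on_carrier[of G \<phi> "GL K V" \<psi>]
  unfolding irreducible_group_rep_def is_group_rep_def by auto

text \<open>The inverse of an intertwiner intertwines. That \<open>(V, \<phi>)\<close> is a
  representation ensures that \<open>\<phi> g\<close> maps \<open>carrier V\<close> to itself, where
  \<open>T\<close> is injective.\<close>

lemma equivalent_group_reps_sym:
  assumes R: "is_group_rep K G (V, \<phi>)" and eq: "equivalent_group_reps K G (V, \<phi>) (W, \<psi>)"
  shows "equivalent_group_reps K G (W, \<psi>) (V, \<phi>)"
proof -
  from eq obtain T where T: "T \<in> linear_maps K V W" "bij_betw T (carrier V) (carrier W)"
    and intertw: "\<And>g v. \<lbrakk>g \<in> carrier G; v \<in> carrier V\<rbrakk> \<Longrightarrow> T (\<phi> g v) = \<psi> g (T v)"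
    unfolding equivalent_group_reps_def by auto
  let ?S = "inv_into (carrier V) T"
  have V: "module K V" and \<phi>: "\<phi> \<in> hom G (GL K V)"
    using R by (auto simp: is_group_rep_def)
  have "?S (\<psi> g w) = \<phi> g (?S w)" if g: "g \<in> carrier G" and w: "w \<in> carrier W" for g w
  proof -
    have Sw: "?S w \<in> carrier V" "T (?S w) = w"
      using T w by (auto simp: bij_betw_def inv_into_into f_inv_into_f)
    have "\<phi> g \<in> linear_maps K V V"
      using hom_in_carrier[OF \<phi> g] by (simp add: GL_def)
    then have "\<phi> g (?S w) \<in> carrier V"
      using Sw by (simp add: linear_maps_closed)
    moreover have "T (\<phi> g (?S w)) = \<psi> g w"
      using intertw g Sw by simp
    ultimately show ?thesis
      using T by (metis bij_betw_def inv_into_f_eq)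
  qed
  then show ?thesis
    unfolding equivalent_group_reps_def
    using linear_maps_inv_into[OF V T] bij_betw_inv_into[OF T(2)] by auto
qed

lemma equivalent_group_reps_trans:
  assumes "equivalent_group_reps K G (V, \<phi>) (W, \<psi>)" and "equivalent_group_reps K G (W, \<psi>) (X, \<chi>)"
  shows "equivalent_group_reps K G (V, \<phi>) (X, \<chi>)"
proof -
  from assms obtain S T
    where S: "S \<in> linear_maps K V W" "bij_betw S (carrier V) (carrier W)"
      "\<forall>g \<in> carrier G. \<forall>v \<in> carrier V. S (\<phi> g v) = \<psi> g (S v)"
      and T: "T \<in> linear_maps K W X" "bij_betw T (carrier W) (carrier X)"
      "\<forall>g \<in> carrier G. \<forall>v \<in> carrier W. T (\<psi> g v) = \<chi> g (T v)"
    unfolding equivalent_group_reps_def by auto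
  have "bij_betw (\<lambda>v. T (S v)) (carrier V) (carrier X)"
    using bij_betw_trans[OF S(2) T(2)] by (simp add: comp_def)
  then show ?thesis
    unfolding equivalent_group_reps_def
    using linear_maps_comp[OF S(1) T(1)] S(3) T(3) linear_maps_closed[OF S(1)]
    by (auto intro!: bexI[of _ "\<lambda>v. T (S v)"])
qed

lemma equiv_irr_group_rep_equiv: "equiv (irr_group_reps K G) (irr_group_rep_equiv K G)"
proof (rule equivI)
  show "irr_group_rep_equiv K G \<subseteq> irr_group_reps K G \<times> irr_group_reps K G"
    by (auto simp: irr_group_rep_equiv_def)
  show "refl_on (irr_group_reps K G) (irr_group_rep_equiv K G)"
    by (auto simp: refl_on_def irr_group_rep_equiv_def intro!: equivalent_group_reps_cong)
  show "sym (irr_group_rep_equiv K G)"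
    by (auto simp: sym_def irr_group_rep_equiv_def irr_group_reps_def irreducible_group_rep_def
        intro: equivalent_group_reps_sym)
  show "trans (irr_group_rep_equiv K G)"
    by (auto simp: trans_def irr_group_rep_equiv_def intro: equivalent_group_reps_trans)
qed

section \<open>The semidirect product attached to a skew left brace\<close>

context skew_left_brace
begin

lemma circ_closed:
  "\<lbrakk>a \<in> carrier D; b \<in> carrier D\<rbrakk> \<Longrightarrow> a \<otimes>\<^bsub>C\<^esub> b \<in> carrier D"
  using C.m_closed carrier_eq by simp

lemma circ_one_D:
  assumes a: "a \<in> carrier D"
  shows "a \<otimes>\<^bsub>C\<^esub> \<one>\<^bsub>D\<^esub> = a"
proof -
  let ?x = "a \<otimes>\<^bsub>C\<^esub> \<one>\<^bsub>D\<^esub>"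
  have x: "?x \<in> carrier D"
    using a circ_closed by simp
  \<comment> \<open>This is the brace identity with \<open>b = c = 1\<close>. Cancelling
    \<open>?x\<close> on the right leaves \<open>?x\<close> times the inverse of \<open>a\<close>
    equal to 1.\<close>
  have "?x = ?x \<otimes>\<^bsub>D\<^esub> inv\<^bsub>D\<^esub> a \<otimes>\<^bsub>D\<^esub> ?x"
    using brace_compat[OF a D.one_closed D.one_closed] by simp
  then have "?x \<otimes>\<^bsub>D\<^esub> inv\<^bsub>D\<^esub> a = \<one>\<^bsub>D\<^esub>"
    using a x by (metis D.inv_closed D.m_closed D.r_cancel_one')
  then show ?thesis
    using a x by (metis D.inv_equality D.inv_inv D.inv_closed)
qed

lemma one_C_eq: "\<one>\<^bsub>C\<^esub> = \<one>\<^bsub>D\<^esub>"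
  using circ_one_D[of "\<one>\<^bsub>C\<^esub>"] C.one_closed C.l_one[of "\<one>\<^bsub>D\<^esub>"] carrier_eq D.one_closed
  by metis

lemma one_D_circ: "a \<in> carrier D \<Longrightarrow> \<one>\<^bsub>D\<^esub> \<otimes>\<^bsub>C\<^esub> a = a"
  using C.l_one[of a] carrier_eq one_C_eq by simp

lemma lambda_op_closed:
  "\<lbrakk>a \<in> carrier D; b \<in> carrier D\<rbrakk> \<Longrightarrow> lambda_op D C a b \<in> carrier D"
  by (simp add: lambda_op_def circ_closed)

lemma lambda_op_one: "a \<in> carrier D \<Longrightarrow> lambda_op D C a \<one>\<^bsub>D\<^esub> = \<one>\<^bsub>D\<^esub>"
  by (simp add: lambda_op_def circ_one_D)

lemma lambda_op_one_left: "a \<in> carrier D \<Longrightarrow> lambda_op D C \<one>\<^bsub>D\<^esub> a = a"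
  by (simp add: lambda_op_def one_D_circ)

lemma lambda_op_mult:
  assumes "a \<in> carrier D" "b \<in> carrier D" "c \<in> carrier D"
  shows "lambda_op D C a (b \<otimes>\<^bsub>D\<^esub> c) = lambda_op D C a b \<otimes>\<^bsub>D\<^esub> lambda_op D C a c"
  using assms by (simp add: lambda_op_def brace_compat D.m_assoc circ_closed)

lemma lambda_op_circ:
  assumes a: "a \<in> carrier D" and b: "b \<in> carrier D" and c: "c \<in> carrier D"
  shows "lambda_op D C (a \<otimes>\<^bsub>C\<^esub> b) c = lambda_op D C a (lambda_op D C b c)"
proof -
  have bc: "b \<otimes>\<^bsub>C\<^esub> c = lambda_op D C b c \<otimes>\<^bsub>D\<^esub> b"
    using b c by (simp add: lambda_op_def D.m_assoc circ_closed)
  have "(a \<otimes>\<^bsub>C\<^esub> b) \<otimes>\<^bsub>C\<^esub> c = a \<otimes>\<^bsub>C\<^esub> (b \<otimes>\<^bsub>C\<^esub> c)"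
    using a b c carrier_eq by (simp add: C.m_assoc)
  \<comment> \<open>The brace identity splits the circle product of \<open>a\<close> with a
    \<open>D\<close>-product; its first two factors form a value of
    \<open>lambda_op D C a\<close>.\<close>
  also have "\<dots> = lambda_op D C a (lambda_op D C b c) \<otimes>\<^bsub>D\<^esub> (a \<otimes>\<^bsub>C\<^esub> b)"
    using a b c unfolding bc
    by (simp add: brace_compat lambda_op_closed lambda_op_def[of D C a])
  finally show ?thesis
    using a b c by (simp add: lambda_op_def[of D C "a \<otimes>\<^bsub>C\<^esub> b"] D.m_assoc circ_closed lambda_op_closed)
qed

lemma group_Lambda_op: "group (Lambda_op D C)"
proof (rule groupI)
  fix x assume "x \<in> carrier (Lambda_op D C)"
  then obtain a b where x: "x = (a, b)" "a \<in> carrier D" "b \<in> carrier D"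
    by (auto simp: Lambda_op_def carrier_eq)
  let ?b = "inv\<^bsub>C\<^esub> b"
  have b: "?b \<in> carrier D" "?b \<otimes>\<^bsub>C\<^esub> b = \<one>\<^bsub>D\<^esub>"
    using x carrier_eq C.inv_closed[of b] one_C_eq by simp_all
  \<comment> \<open>The left inverse in a semidirect product: acting by \<open>?b\<close> turns
    \<open>a\<close> into \<open>lambda_op D C ?b a\<close>, which the first component must
    cancel.\<close>
  show "\<exists>y \<in> carrier (Lambda_op D C). y \<otimes>\<^bsub>Lambda_op D C\<^esub> x = \<one>\<^bsub>Lambda_op D C\<^esub>"
    using x b
    by (intro bexI[of _ "(inv\<^bsub>D\<^esub> (lambda_op D C ?b a), ?b)"])
      (simp_all add: Lambda_op_def carrier_eq one_C_eq lambda_op_closed)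
qed (auto simp: Lambda_op_def carrier_eq one_C_eq circ_closed lambda_op_closed lambda_op_one_left
    lambda_op_mult lambda_op_circ D.m_assoc
    C.m_assoc[unfolded carrier_eq] one_D_circ)

section \<open>From representations of the semidirect product back to the brace\<close>

lemma ex_brace_rep_of_Lambda_op_rep:
  assumes V: "module K V" and \<phi>: "\<phi> \<in> hom (Lambda_op D C) (GL K V)"
  obtains \<beta> \<rho> where "is_brace_rep K D C (V, \<beta>, \<rho>)"
    and "\<And>a b. \<lbrakk>a \<in> carrier D; b \<in> carrier D\<rbrakk> \<Longrightarrow> \<beta> a \<otimes>\<^bsub>GL K V\<^esub> \<rho> b = \<phi> (a, b)"
proof
  interpret GL: group "GL K V" by (rule group_GL[OF V])
  have closed: "\<phi> (a, b) \<in> carrier (GL K V)" if "a \<in> carrier D" "b \<in> carrier D" for a b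
    using hom_in_carrier[OF \<phi>, of "(a, b)"] that carrier_eq by (simp add: Lambda_op_def)
  have mult: "\<phi> (a, b) \<otimes>\<^bsub>GL K V\<^esub> \<phi> (a', b') =
      \<phi> (a \<otimes>\<^bsub>D\<^esub> lambda_op D C b a', b \<otimes>\<^bsub>C\<^esub> b')"
    if "a \<in> carrier D" "b \<in> carrier D" "a' \<in> carrier D" "b' \<in> carrier D" for a b a' b'
    using hom_mult[OF \<phi>, of "(a, b)" "(a', b')"] that carrier_eq by (simp add: Lambda_op_def)
  let ?\<beta> = "\<lambda>a. \<phi> (a, \<one>\<^bsub>D\<^esub>)" and ?\<rho> = "\<lambda>b. \<phi> (\<one>\<^bsub>D\<^esub>, b)"
  show "?\<beta> a \<otimes>\<^bsub>GL K V\<^esub> ?\<rho> b = \<phi> (a, b)" if "a \<in> carrier D" "b \<in> carrier D" for a b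
    using that by (simp add: mult lambda_op_one one_D_circ)
  have "?\<beta> \<in> hom D (GL K V)"
    by (rule homI) (simp_all add: closed mult lambda_op_one_left one_D_circ)
  moreover have "?\<rho> \<in> hom C (GL K V)"
    by (rule homI) (simp_all add: closed mult lambda_op_one carrier_eq)
  moreover have "?\<beta> (lambda_op D C a b) = ?\<rho> a \<otimes>\<^bsub>GL K V\<^esub> ?\<beta> b \<otimes>\<^bsub>GL K V\<^esub> inv\<^bsub>GL K V\<^esub> (?\<rho> a)"
    if "a \<in> carrier D" "b \<in> carrier D" for a b
  proof -
    \<comment> \<open>Both sides equal \<open>\<phi> (lambda_op D C a b, a)\<close>.\<close>
    have "?\<beta> (lambda_op D C a b) \<otimes>\<^bsub>GL K V\<^esub> ?\<rho> a = ?\<rho> a \<otimes>\<^bsub>GL K V\<^esub> ?\<beta> b"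
      using that by (simp add: mult lambda_op_closed lambda_op_one one_D_circ circ_one_D)
    then show ?thesis
      using that by (simp add: GL.inv_solve_right closed lambda_op_closed)
  qed
  ultimately show "is_brace_rep K D C (V, ?\<beta>, ?\<rho>)"
    using V by (simp add: is_brace_rep_def)
qed

text \<open>This is the surjectivity on classes. Only equivalence is claimed, because
  \<open>Lambda_rep\<close> of the recovered brace representation agrees with the given action on
  the carrier of the group but possibly not outside it.\<close>

lemma ex_irr_brace_rep:
  assumes "R \<in> irr_group_reps K (Lambda_op D C)"
  shows "\<exists>S \<in> irr_brace_reps K D C. (Lambda_rep K S, R) \<in> irr_group_rep_equiv K (Lambda_op D C)"
proof -
  obtain V \<phi> where R: "R = (V, \<phi>)" by force
  have irr: "irreducible_group_rep K (Lambda_op D C) (V, \<phi>)"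
    using assms by (simp add: R irr_group_reps_def)
  then have "module K V" "\<phi> \<in> hom (Lambda_op D C) (GL K V)"
    by (auto simp: irreducible_group_rep_def is_group_rep_def)
  then obtain \<beta> \<rho> where br: "is_brace_rep K D C (V, \<beta>, \<rho>)"
    and eq: "\<And>a b. \<lbrakk>a \<in> carrier D; b \<in> carrier D\<rbrakk> \<Longrightarrow> \<beta> a \<otimes>\<^bsub>GL K V\<^esub> \<rho> b = \<phi> (a, b)"
    by (rule ex_brace_rep_of_Lambda_op_rep) (rule that)
  let ?\<psi> = "\<lambda>(a, b). \<beta> a \<otimes>\<^bsub>GL K V\<^esub> \<rho> b"
  have \<psi>: "?\<psi> g = \<phi> g" if "g \<in> carrier (Lambda_op D C)" for g
    using that eq carrier_eq by (auto simp: Lambda_op_def)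
  have rep: "Lambda_rep K (V, \<beta>, \<rho>) = (V, ?\<psi>)"
    by (simp add: Lambda_rep_def)
  have "irreducible_group_rep K (Lambda_op D C) (V, ?\<psi>)"
    by (rule irreducible_group_rep_cong[OF group_Lambda_op irr \<psi>])
  moreover have "equivalent_group_reps K (Lambda_op D C) (V, ?\<psi>) (V, \<phi>)"
    by (rule equivalent_group_reps_cong[OF \<psi>])
  ultimately show ?thesis
    using br irr
    by (intro bexI[of _ "(V, \<beta>, \<rho>)"]) (simp_all add: R rep irr_brace_reps_def
        irreducible_brace_rep_def irr_group_rep_equiv_def irr_group_reps_def)
qed

end

theorem corollary4p7:
  fixes K :: "'k ring" and D C :: "'a monoid"
  assumes "field K" and "skew_left_brace D C"
  shows "\<exists>F :: ('a, 'k, 'v) brace_rep set \<Rightarrow> ('a \<times> 'a, 'k, 'v) group_rep set.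
    bij_betw F
      (irr_brace_reps K D C // irr_brace_rep_equiv K D C)
      (irr_group_reps K (Lambda_op D C) // irr_group_rep_equiv K (Lambda_op D C)) \<and>
    (\<forall>R \<in> irr_brace_reps K D C.
      F (irr_brace_rep_equiv K D C `` {R}) =
        irr_group_rep_equiv K (Lambda_op D C) `` {Lambda_rep K R})"
proof (rule bij_betw_quotient_pullback[OF equiv_irr_group_rep_equiv])
  show "Lambda_rep K ` irr_brace_reps K D C \<subseteq> irr_group_reps K (Lambda_op D C)"
    by (auto simp: irr_brace_reps_def irr_group_reps_def irreducible_brace_rep_def)
  \<comment> \<open>The inclusion just shown supplies the irreducibility of both images that
    membership in \<open>irr_group_rep_equiv\<close> demands.\<close>
  then show "irr_brace_rep_equiv K D C = {(R, S). R \<in> irr_brace_reps K D C \<and>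
      S \<in> irr_brace_reps K D C \<and>
      (Lambda_rep K R, Lambda_rep K S) \<in> irr_group_rep_equiv K (Lambda_op D C)}"
    by (auto simp: irr_brace_rep_equiv_def irr_group_rep_equiv_def equivalent_brace_reps_def)
qed (rule skew_left_brace.ex_irr_brace_rep[OF assms(2)])

end
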